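(* Let $f\in H^2_d\cap C(\overline{\mathbb B_d})$ and assume that $Z(f)\cap\partial\mathbb B_d$ contains an embedded cube of dimension $m\ge3$. Then $f$ is not cyclic in $H^2_d$.
   Context: $d\in\mathbb N$, $\mathbb B_d$ is the open unit ball of $\mathbb C^d$. The Drury-Arveson space $H^2_d$ is the Hilbert space of analytic functions $f(z)=\sum_{\alpha\in\mathbb N_0^d}\hat f(\alpha)z^\alpha$ on $\mathbb B_d$ with $\|f\|^2_{H^2_d}=\sum_{\alpha\in\mathbb N_0^d}\frac{\alpha!}{|\alpha|!}|\hat f(\alpha)|^2<\infty$. $f\in H^2_d\cap C(\overline{\mathbb B_d})$ means that $f\in H^2_d$ extends continuously to $\overline{\mathbb B_d}$, and $Z(f)=\{z\in\overline{\mathbb B_d}:f(z)=0\}$. $\mathrm{Mult}(H^2_d)=\{\varphi:\varphi f\in H^2_d\text{ for all }f\in H^2_d\}$; $f\in H^2_d$ is cyclic if the closure in $H^2_d$ of $\{\varphi f:\varphi\in\mathrm{Mult}(H^2_d)\}$ equals $H^2_d$. A set $S\subseteq\mathbb C^d$ contains an embedded cube of dimension $m$ (an integer $m\ge0$) if there exists a diffeomorphism $\phi$ from $(-1,1)^m$ into $S$, i.e. a diffeomorphism of $(-1,1)^m$ onto its image, an embedded real submanifold of $\mathbb C^d\cong\mathbb R^{2d}$ contained in $S$. *)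

theory Defs
  imports "HOL-Analysis.Analysis"
begin

section \<open>The Drury-Arveson space\<close>

text \<open>
  Functions on the unit ball of \<open>\<complex>\<^sup>d\<close> are total functions on \<^typ>\<open>complex ^ 'd\<close>; only their values
  on \<open>ball 0 1\<close> matter for everything in this section. Multi-indices are functions \<^typ>\<open>'d \<Rightarrow> nat\<close>.
\<close>

definition multi_power :: "complex ^ 'd \<Rightarrow> ('d::finite \<Rightarrow> nat) \<Rightarrow> complex" where
  "multi_power z \<alpha> = (\<Prod>i\<in>UNIV. (z $ i) ^ \<alpha> i)"

definition power_expansion :: "(complex ^ 'd \<Rightarrow> complex) \<Rightarrow> (('d::finite \<Rightarrow> nat) \<Rightarrow> complex) \<Rightarrow> bool" where
  "power_expansion f c \<longleftrightarrow> (\<forall>z\<in>ball 0 1. ((\<lambda>\<alpha>. c \<alpha> * multi_power z \<alpha>) has_sum f z) UNIV)"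

text \<open>
  A function is analytic on the ball iff it has such an expansion (the ball is a complete Reinhardt
  domain, so the Taylor series at the origin converges absolutely on all of it), and the
  coefficients are then unique, so the description below is proper.
\<close>

definition analytic_on_ball :: "(complex ^ 'd::finite \<Rightarrow> complex) \<Rightarrow> bool" where
  "analytic_on_ball f \<longleftrightarrow> (\<exists>c. power_expansion f c)"

definition taylor_coeff :: "(complex ^ 'd \<Rightarrow> complex) \<Rightarrow> ('d::finite \<Rightarrow> nat) \<Rightarrow> complex" where
  "taylor_coeff f = (THE c. power_expansion f c)"

definition da_weight :: "('d::finite \<Rightarrow> nat) \<Rightarrow> real" where
  "da_weight \<alpha> = (\<Prod>i\<in>UNIV. fact (\<alpha> i)) / fact (\<Sum>i\<in>UNIV. \<alpha> i)"

definition drury_arveson :: "(complex ^ 'd::finite \<Rightarrow> complex) set" where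
  "drury_arveson = {f. analytic_on_ball f \<and>
     (\<lambda>\<alpha>. da_weight \<alpha> * (cmod (taylor_coeff f \<alpha>))\<^sup>2) summable_on UNIV}"

definition da_norm :: "(complex ^ 'd::finite \<Rightarrow> complex) \<Rightarrow> real" where
  "da_norm f = sqrt (\<Sum>\<^sub>\<infinity>\<alpha>\<in>UNIV. da_weight \<alpha> * (cmod (taylor_coeff f \<alpha>))\<^sup>2)"

definition da_closure :: "(complex ^ 'd::finite \<Rightarrow> complex) set \<Rightarrow> (complex ^ 'd \<Rightarrow> complex) set" where
  "da_closure S = {g \<in> drury_arveson. \<forall>\<epsilon>>0. \<exists>h\<in>S. da_norm (\<lambda>z. g z - h z) < \<epsilon>}"

definition da_multipliers :: "(complex ^ 'd::finite \<Rightarrow> complex) set" where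
  "da_multipliers = {\<phi>. \<forall>f\<in>drury_arveson. (\<lambda>z. \<phi> z * f z) \<in> drury_arveson}"

definition da_cyclic :: "(complex ^ 'd::finite \<Rightarrow> complex) \<Rightarrow> bool" where
  "da_cyclic f \<longleftrightarrow> f \<in> drury_arveson \<and>
     da_closure ((\<lambda>\<phi> z. \<phi> z * f z) ` da_multipliers) = drury_arveson"

text \<open>
  Used for \<open>f\<close> continuous on the closed ball, so that the values of \<open>f\<close> on the unit sphere are those
  of the continuous extension.
\<close>

definition zero_set :: "(complex ^ 'd::finite \<Rightarrow> complex) \<Rightarrow> (complex ^ 'd) set" where
  "zero_set f = {z \<in> cball 0 1. f z = 0}"


section \<open>Embedded cubes\<close>

text \<open>\<open>Ck_on k U f\<close>: all partial derivatives of \<open>f\<close> up to order \<open>k\<close> exist and are continuous on the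
  open set \<open>U\<close>; derivatives are real.\<close>

primrec Ck_on :: "nat \<Rightarrow> 'a::euclidean_space set \<Rightarrow> ('a \<Rightarrow> 'b::real_normed_vector) \<Rightarrow> bool" where
  "Ck_on 0 U f \<longleftrightarrow> continuous_on U f"
| "Ck_on (Suc k) U f \<longleftrightarrow> (\<forall>x\<in>U. f differentiable (at x)) \<and>
     (\<forall>v. Ck_on k U (\<lambda>x. frechet_derivative f (at x) v))"

text \<open>
  Smoothness of a map defined on an arbitrary subset \<open>S\<close> of a Euclidean space: locally it has a
  \<open>C\<^sup>\<infinity>\<close> extension to an open set.
\<close>

definition smooth_map_on :: "'a::euclidean_space set \<Rightarrow> ('a \<Rightarrow> 'b::real_normed_vector) \<Rightarrow> bool" where
  "smooth_map_on S f \<longleftrightarrow> (\<forall>x\<in>S. \<exists>U g. open U \<and> x \<in> U \<and> (\<forall>k. Ck_on k U g) \<and> (\<forall>y\<in>S \<inter> U. g y = f y))"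

definition diffeomorphism_between ::
  "'a::euclidean_space set \<Rightarrow> 'b::euclidean_space set \<Rightarrow> ('a \<Rightarrow> 'b) \<Rightarrow> bool" where
  "diffeomorphism_between S T \<phi> \<longleftrightarrow>
     bij_betw \<phi> S T \<and> smooth_map_on S \<phi> \<and> smooth_map_on T (inv_into S \<phi>)"

definition open_cube :: "(real ^ 'm::finite) set" where
  "open_cube = {x. \<forall>i. -1 < x $ i \<and> x $ i < 1}"

text \<open>
  The dimension of the cube is \<open>CARD('m)\<close>. A subset of a Euclidean space that is diffeomorphic, in the
  above sense, to an open subset of \<open>\<real>\<^sup>m\<close> is an embedded \<open>m\<close>-dimensional submanifold.
\<close>

definition contains_embedded_cube :: "'m::finite itself \<Rightarrow> (complex ^ 'd::finite) set \<Rightarrow> bool" where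
  "contains_embedded_cube _ S \<longleftrightarrow>
     (\<exists>\<phi> :: real ^ 'm \<Rightarrow> complex ^ 'd.
        \<phi> ` open_cube \<subseteq> S \<and> diffeomorphism_between open_cube (\<phi> ` open_cube) \<phi>)"

end

theory Submission
  imports Defs "HOL-Complex_Analysis.Cauchy_Integral_Formula"
begin

text \<open>
  The reproducing kernel of the Drury-Arveson space is \<open>1 / (1 - \<langle>z, w\<rangle>)\<close>. For unit vectors the real
  part of \<open>1 - \<langle>z, w\<rangle>\<close> is \<open>|z - w|\<^sup>2 / 2\<close>, so on the sphere the modulus of the kernel is at most
  \<open>2 / |z - w|\<^sup>2\<close>. This singularity is integrable in real dimension three or more, so an embedded
  cube in the sphere carries a probability measure of finite energy, namely one that lives on a
  three-dimensional slice. Integration against such a measure is a bounded functional on the space that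
  does not vanish on the constant \<open>1\<close>; if \<open>f\<close> vanishes on the cube, the functional annihilates
  all \<open>\<psi> f\<close> with a multiplier \<open>\<psi>\<close>, so \<open>1\<close> is not in the closure of these products.

  The measures are replaced by uniform distributions on finite grids, moved to the sphere of
  radius \<open>r < 1\<close>. All integrals then become finite sums, and the regularization by \<open>r\<close> keeps the diagonal
  terms finite. The analytic side is the inequality \<open>evaluation_energy_bound\<close>, which bounds the
  sum of \<open>|g|\<close> over finitely many points by the norm of \<open>g\<close> and the energy of the points, and
  rests on Cauchy-Schwarz, the multinomial expansion of the kernel and the uniqueness of Taylor
  coefficients. It controls \<open>|g|\<close> and not only \<open>g\<close> because the moduli of the kernel values have bounded
  sums. Applied to the multiplier itself, it replaces the boundedness of multipliers on the ball:
  see \<open>not_cyclic_of_bounded_energy\<close>. The geometric side is that the energy of the grids, divided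
  by the square of the number of points, stays bounded (\<open>spherical_grid_energy\<close>). It combines the
  lattice sum \<open>lattice_cube_energy\<close> with the fact that a diffeomorphism does not contract
  distances by more than a constant factor near a point (\<open>diffeomorphism_locally_expanding\<close>).
\<close>

section \<open>Uniqueness of Taylor coefficients\<close>

lemma power_series_coefficients_zero:
  fixes a :: "nat \<Rightarrow> complex"
  assumes "0 < r" and sm: "\<And>t. cmod t < r \<Longrightarrow> (\<lambda>n. a n * t ^ n) sums 0"
  shows "a n = 0"
proof (rule ccontr)
  assume an: "a n \<noteq> 0"
  have "(\<lambda>n. a n * 0 ^ n) sums a 0" by (rule powser_sums_zero)
  with sm[of 0] \<open>0 < r\<close> have "a 0 = 0" by (auto dest: sums_unique2)
  with an have "n > 0" by (cases n) auto
  obtain s where "0 < s" "\<And>z. z \<in> cball (0::complex) s - {0} \<Longrightarrow> (0::complex) \<noteq> 0"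
    by (rule powser_0_nonzero[where a=a and f="\<lambda>_. 0" and \<xi>=0 and m=n and r=r])
       (use assms an \<open>n > 0\<close> in auto)
  moreover have "of_real s \<in> cball (0::complex) s - {0}" using \<open>0 < s\<close> by simp
  ultimately show False by blast
qed

text \<open>
  Induction on the set \<open>I\<close> of active variables: with the other variables fixed, the sum is a
  power series in the new variable that vanishes near \<open>0\<close>, so each of its coefficients, which is a
  sum over the multi-indices with one exponent prescribed, vanishes, and the induction hypothesis
  applies to that sum. The index set \<open>A\<close> is arbitrary so that it can shrink in this way; as its
  elements are determined by their exponents in \<open>I\<close>, at most one of them is left at the end.
\<close>
lemma monomial_coefficients_zero:
  fixes c :: "('i \<Rightarrow> nat) \<Rightarrow> complex"
  assumes "finite I" "0 < \<rho>" "\<alpha> \<in> A"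
    and "\<And>z. (\<And>i. cmod (z i) < \<rho>) \<Longrightarrow> ((\<lambda>\<alpha>. c \<alpha> * (\<Prod>i\<in>I. z i ^ \<alpha> i)) has_sum 0) A"
    and "\<And>\<alpha> \<beta>. \<alpha> \<in> A \<Longrightarrow> \<beta> \<in> A \<Longrightarrow> (\<And>i. i \<in> I \<Longrightarrow> \<alpha> i = \<beta> i) \<Longrightarrow> \<alpha> = \<beta>"
  shows "c \<alpha> = 0"
  using assms(1,3-)
proof (induction I arbitrary: A \<alpha> rule: finite_induct)
  case empty
  then have "A = {\<alpha>}" by blast
  moreover have "(c has_sum 0) A" using empty(2)[of "\<lambda>_. 0"] \<open>0 < \<rho>\<close> by simp
  ultimately show ?case using has_sum_unique[OF _ has_sum_finite[of "{\<alpha>}" c]] by force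
next
  case (insert i I)
  define B where "B n = {\<alpha>\<in>A. \<alpha> i = n}" for n
  have "((\<lambda>\<alpha>. c \<alpha> * (\<Prod>i\<in>I. z i ^ \<alpha> i)) has_sum 0) (B n)"
    if z: "\<And>i. cmod (z i) < \<rho>" for z n
  proof -
    define P where "P \<alpha> = c \<alpha> * (\<Prod>i\<in>I. z i ^ \<alpha> i)" for \<alpha>
    have sumA: "((\<lambda>\<alpha>. t ^ \<alpha> i * P \<alpha>) has_sum 0) A" if "cmod t < \<rho>" for t
    proof -
      have "(\<Prod>j\<in>I. (z(i:=t)) j ^ \<alpha> j) = (\<Prod>j\<in>I. z j ^ \<alpha> j)" for \<alpha>
        by (rule prod.cong) (use insert.hyps in auto)
      moreover have "((\<lambda>\<alpha>. c \<alpha> * (\<Prod>j\<in>insert i I. (z(i:=t)) j ^ \<alpha> j)) has_sum 0) A"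
        by (rule insert.prems) (use that z in auto)
      ultimately show ?thesis
        using insert.hyps by (simp add: P_def mult_ac)
    qed
    have PB: "P summable_on (B n)" for n
    proof -
      have "(\<lambda>\<alpha>. complex_of_real (\<rho>/2) ^ \<alpha> i * P \<alpha>) summable_on A"
        using sumA[of "complex_of_real (\<rho>/2)"] \<open>0 < \<rho>\<close> by (auto simp: summable_on_def)
      then have "(\<lambda>\<alpha>. complex_of_real (\<rho>/2) ^ \<alpha> i * P \<alpha>) summable_on (B n)"
        by (rule summable_on_subset_banach) (auto simp: B_def)
      then have "(\<lambda>\<alpha>. complex_of_real (\<rho>/2) ^ n * P \<alpha>) summable_on (B n)"
        by (subst (asm) summable_on_cong[where g="\<lambda>\<alpha>. complex_of_real (\<rho>/2) ^ n * P \<alpha>"])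
           (auto simp: B_def)
      then show ?thesis
        using \<open>0 < \<rho>\<close> by (subst (asm) summable_on_cmult_right') auto
    qed
    have "(\<lambda>n. infsum P (B n) * t ^ n) sums 0" if "cmod t < \<rho>" for t
    proof -
      have A: "A = snd ` (SIGMA n:UNIV. B n)" by (force simp: B_def)
      have inj: "inj_on snd (SIGMA n:UNIV. B n)" by (auto simp: inj_on_def B_def)
      have "((\<lambda>\<alpha>. t ^ \<alpha> i * P \<alpha>) has_sum 0) (snd ` (SIGMA n:UNIV. B n))"
        using sumA[OF that] by (simp flip: A)
      then have "((\<lambda>\<alpha>. t ^ \<alpha> i * P \<alpha>) \<circ> snd has_sum 0) (SIGMA n:UNIV. B n)"
        by (simp only: has_sum_reindex[OF inj])
      then have "((\<lambda>(n,\<alpha>). t ^ n * P \<alpha>) has_sum 0) (SIGMA n:UNIV. B n)"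
        by (rule has_sum_cong[THEN iffD1, rotated]) (auto simp: B_def)
      then have "((\<lambda>n. t ^ n * infsum P (B n)) has_sum 0) UNIV"
        by (rule has_sum_SigmaD) (auto intro!: has_sum_cmult_right has_sum_infsum PB)
      then show ?thesis by (auto dest: has_sum_imp_sums simp: mult.commute)
    qed
    then have "infsum P (B n) = 0"
      using power_series_coefficients_zero[OF \<open>0 < \<rho>\<close>, of "\<lambda>n. infsum P (B n)"] by auto
    then show ?thesis using has_sum_infsum[OF PB[of n]] by (simp add: P_def[abs_def])
  qed
  moreover have "\<alpha> = \<beta>" if "\<alpha> \<in> B n" "\<beta> \<in> B n" "\<And>i. i \<in> I \<Longrightarrow> \<alpha> i = \<beta> i" for \<alpha> \<beta> n
  proof (rule insert.prems(3))
    show "\<alpha> j = \<beta> j" if "j \<in> insert i I" for j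
      using that \<open>\<alpha> \<in> B n\<close> \<open>\<beta> \<in> B n\<close> \<open>\<And>i. i \<in> I \<Longrightarrow> \<alpha> i = \<beta> i\<close> by (auto simp: B_def)
  qed (use that in \<open>auto simp: B_def\<close>)
  moreover have "\<alpha> \<in> B (\<alpha> i)" using insert.prems by (simp add: B_def)
  ultimately show ?case by (intro insert.IH[of \<alpha> "B (\<alpha> i)"]) auto
qed

lemma power_expansion_unique:
  fixes c c' :: "('d::finite \<Rightarrow> nat) \<Rightarrow> complex"
  assumes "power_expansion f c" "power_expansion f c'"
  shows "c = c'"
proof
  fix \<alpha> :: "'d \<Rightarrow> nat"
  \<comment> \<open>A polydisc with this radius lies in the ball.\<close>
  define \<rho> :: real where "\<rho> = 1 / CARD('d)"
  have "c \<alpha> - c' \<alpha> = 0"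
  proof (rule monomial_coefficients_zero[where I=UNIV and A=UNIV and \<rho>=\<rho>
        and c="\<lambda>\<alpha>. c \<alpha> - c' \<alpha>"])
    fix z :: "'d \<Rightarrow> complex" assume z: "\<And>i. cmod (z i) < \<rho>"
    define w :: "complex ^ 'd" where "w = (\<chi> i. z i)"
    have "norm w \<le> (\<Sum>i\<in>UNIV. cmod (z i))"
      unfolding norm_vec_def w_def by (simp add: L2_set_le_sum)
    also have "\<dots> < (\<Sum>i\<in>(UNIV::'d set). \<rho>)" by (rule sum_strict_mono) (use z in auto)
    also have "\<dots> = 1" by (simp add: \<rho>_def)
    finally have "w \<in> ball 0 1" by simp
    then have "((\<lambda>\<alpha>. c \<alpha> * multi_power w \<alpha>) has_sum f w) UNIV"
      "((\<lambda>\<alpha>. c' \<alpha> * multi_power w \<alpha>) has_sum f w) UNIV"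
      using assms by (auto simp: power_expansion_def)
    from has_sum_add[OF this(1) has_sum_uminusI[OF this(2)]]
    show "((\<lambda>\<alpha>. (c \<alpha> - c' \<alpha>) * (\<Prod>i\<in>UNIV. z i ^ \<alpha> i)) has_sum 0) UNIV"
      by (simp add: algebra_simps multi_power_def w_def)
  qed (auto simp: \<rho>_def)
  then show "c \<alpha> = c' \<alpha>" by simp
qed

lemma taylor_coeff_eq: "power_expansion f c \<Longrightarrow> taylor_coeff f = c"
  unfolding taylor_coeff_def by (rule the_equality) (auto intro: power_expansion_unique)

lemma power_expansion_taylor_coeff:
  "f \<in> drury_arveson \<Longrightarrow> power_expansion f (taylor_coeff f)"
  by (auto simp: drury_arveson_def analytic_on_ball_def taylor_coeff_eq)

section \<open>The Drury-Arveson space\<close>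

lemma da_weight_pos: "da_weight \<alpha> > 0"
  by (auto simp: da_weight_def intro!: divide_pos_pos prod_pos)

lemma drury_arveson_diff:
  assumes "f \<in> drury_arveson" "g \<in> drury_arveson"
  shows "(\<lambda>z. f z - g z) \<in> drury_arveson"
proof -
  let ?a = "taylor_coeff f" and ?b = "taylor_coeff g"
  have exp: "power_expansion (\<lambda>z. f z - g z) (\<lambda>\<alpha>. ?a \<alpha> - ?b \<alpha>)"
    unfolding power_expansion_def
  proof
    fix z :: "complex^'a" assume z: "z \<in> ball 0 1"
    then have "((\<lambda>\<alpha>. ?a \<alpha> * multi_power z \<alpha>) has_sum f z) UNIV"
      "((\<lambda>\<alpha>. ?b \<alpha> * multi_power z \<alpha>) has_sum g z) UNIV"
      using assms[THEN power_expansion_taylor_coeff] by (auto simp: power_expansion_def)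
    from has_sum_add[OF this(1) has_sum_uminusI[OF this(2)]]
    show "((\<lambda>\<alpha>. (?a \<alpha> - ?b \<alpha>) * multi_power z \<alpha>) has_sum f z - g z) UNIV"
      by (simp add: algebra_simps)
  qed
  have "(\<lambda>\<alpha>. 2 * (da_weight \<alpha> * (cmod (?a \<alpha>))\<^sup>2) + 2 * (da_weight \<alpha> * (cmod (?b \<alpha>))\<^sup>2)) summable_on UNIV"
    using assms by (intro summable_on_add summable_on_cmult_right) (auto simp: drury_arveson_def)
  then have "(\<lambda>\<alpha>. da_weight \<alpha> * (cmod (?a \<alpha> - ?b \<alpha>))\<^sup>2) summable_on UNIV"
  proof (rule summable_on_comparison_test)
    fix \<alpha> :: "'a \<Rightarrow> nat"
    have "(cmod (?a \<alpha> - ?b \<alpha>))\<^sup>2 \<le> (cmod (?a \<alpha>) + cmod (?b \<alpha>))\<^sup>2"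
      by (intro power_mono norm_triangle_ineq4) auto
    also have "\<dots> \<le> 2 * (cmod (?a \<alpha>))\<^sup>2 + 2 * (cmod (?b \<alpha>))\<^sup>2"
      using zero_le_power2[of "cmod (?a \<alpha>) - cmod (?b \<alpha>)"] by (simp add: power2_eq_square algebra_simps)
    finally show "da_weight \<alpha> * (cmod (?a \<alpha> - ?b \<alpha>))\<^sup>2 \<le>
        2 * (da_weight \<alpha> * (cmod (?a \<alpha>))\<^sup>2) + 2 * (da_weight \<alpha> * (cmod (?b \<alpha>))\<^sup>2)"
      using da_weight_pos[of \<alpha>] mult_left_mono[of "(cmod (?a \<alpha> - ?b \<alpha>))\<^sup>2" _ "da_weight \<alpha>"]
      by (fastforce simp: algebra_simps)
  qed (auto simp: less_imp_le[OF da_weight_pos])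
  then show ?thesis
    using exp by (auto simp: drury_arveson_def analytic_on_ball_def taylor_coeff_eq[OF exp])
qed

lemma one_in_drury_arveson: "(\<lambda>_. 1) \<in> drury_arveson"
proof -
  let ?c = "\<lambda>\<alpha>. if \<alpha> = (\<lambda>_. 0) then 1 else 0 :: complex"
  have exp: "power_expansion (\<lambda>_::complex^'a. 1) ?c"
    unfolding power_expansion_def
    by (intro ballI has_sum_finite_neutralI[where B="{\<lambda>_. 0}"]) (auto simp: multi_power_def)
  have "(\<lambda>\<alpha>. da_weight \<alpha> * (cmod (?c \<alpha>))\<^sup>2) summable_on (UNIV :: ('a \<Rightarrow> nat) set)"
    by (rule finite_nonzero_values_imp_summable_on[OF finite_subset[of _ "{\<lambda>_. 0}"]]) auto
  then show ?thesis
    using exp by (auto simp: drury_arveson_def analytic_on_ball_def taylor_coeff_eq[OF exp])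
qed

section \<open>The reproducing kernel\<close>

lemma finite_multi_indices_of_degree: "finite {\<alpha> :: 'd::finite \<Rightarrow> nat. (\<Sum>i\<in>UNIV. \<alpha> i) = n}"
proof (rule finite_subset)
  show "{\<alpha>. (\<Sum>i\<in>UNIV. \<alpha> i) = n} \<subseteq> (UNIV::'d set) \<rightarrow>\<^sub>E {..n}"
    by (auto simp: PiE_def member_le_sum)
qed (auto intro: finite_PiE)

text \<open>
  The multinomial theorem, with the coefficient \<open>n! / \<alpha>!\<close> divided by \<open>n!\<close>. In the induction step
  the sum over the multi-indices of degree \<open>n + 1\<close> is multiplied by \<open>n + 1\<close>, written as the sum of
  the entries of \<open>\<alpha>\<close>; the factor \<open>\<alpha> i\<close> cancels against \<open>\<alpha> i!\<close>, which lowers the exponent of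
  \<open>x i\<close> by one.
\<close>
lemma multinomial_fact:
  fixes x :: "'d::finite \<Rightarrow> 'a::real_normed_field"
  shows "(\<Sum>\<alpha> | (\<Sum>i\<in>UNIV. \<alpha> i) = n. \<Prod>i\<in>UNIV. x i ^ \<alpha> i / fact (\<alpha> i)) = (\<Sum>i\<in>UNIV. x i) ^ n / fact n"
proof (induction n)
  case 0
  have "{\<alpha> :: 'd \<Rightarrow> nat. (\<Sum>i\<in>UNIV. \<alpha> i) = 0} = {\<lambda>_. 0}" by auto
  then show ?case by simp
next
  case (Suc n)
  define g where "g \<alpha> = (\<Prod>i\<in>UNIV. x i ^ \<alpha> i / fact (\<alpha> i))" for \<alpha>
  define D where "D n = {\<alpha> :: 'd \<Rightarrow> nat. (\<Sum>i\<in>UNIV. \<alpha> i) = n}" for n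
  have fin: "finite (D n)" for n unfolding D_def by (rule finite_multi_indices_of_degree)
  have IH: "sum g (D n) = (\<Sum>i\<in>UNIV. x i) ^ n / fact n"
    using Suc.IH by (simp add: g_def D_def)
  have deg: "(\<Sum>j\<in>UNIV. (\<beta>(i := Suc (\<beta> i))) j) = Suc (\<Sum>j\<in>UNIV. \<beta> j)" for \<beta> :: "'d \<Rightarrow> nat" and i
    by (simp add: sum.remove[of UNIV i])
  have raise: "of_nat (Suc (\<beta> i)) * g (\<beta>(i := Suc (\<beta> i))) = x i * g \<beta>" for \<beta> i
    by (simp add: g_def prod.remove[of UNIV i] del: of_nat_Suc)
  have step: "(\<Sum>\<alpha>\<in>D (Suc n). of_nat (\<alpha> i) * g \<alpha>) = x i * sum g (D n)" for i
  proof -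
    have "(\<Sum>\<alpha>\<in>D (Suc n). of_nat (\<alpha> i) * g \<alpha>) = (\<Sum>\<alpha>\<in>{\<alpha>\<in>D (Suc n). \<alpha> i > 0}. of_nat (\<alpha> i) * g \<alpha>)"
      by (rule sum.mono_neutral_right) (auto simp: fin)
    also have "\<dots> = (\<Sum>\<beta>\<in>D n. of_nat (Suc (\<beta> i)) * g (\<beta>(i := Suc (\<beta> i))))"
      by (rule sum.reindex_bij_witness[where i="\<lambda>\<beta>. \<beta>(i := Suc (\<beta> i))" and j="\<lambda>\<alpha>. \<alpha>(i := \<alpha> i - 1)"])
         (auto simp: D_def deg sum.remove[of UNIV i])
    also have "\<dots> = x i * sum g (D n)" by (simp only: raise sum_distrib_left)
    finally show ?thesis .
  qed
  have "of_nat (Suc n) * sum g (D (Suc n)) = (\<Sum>\<alpha>\<in>D (Suc n). (\<Sum>i\<in>UNIV. of_nat (\<alpha> i)) * g \<alpha>)"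
    unfolding sum_distrib_left by (rule sum.cong) (auto simp: D_def simp flip: of_nat_sum)
  also have "\<dots> = (\<Sum>i\<in>UNIV. \<Sum>\<alpha>\<in>D (Suc n). of_nat (\<alpha> i) * g \<alpha>)"
    by (simp add: sum_distrib_right sum.swap[of _ _ UNIV])
  also have "\<dots> = (\<Sum>i\<in>UNIV. x i) ^ Suc n / fact n"
    by (simp add: step IH sum_distrib_right sum_divide_distrib)
  finally have "sum g (D (Suc n)) = (\<Sum>i\<in>UNIV. x i) ^ Suc n / fact n / of_nat (Suc n)"
    by (simp add: field_simps del: of_nat_Suc)
  then show ?case by (simp add: g_def D_def)
qed

lemma multinomial_da_weight:
  fixes x :: "'d::finite \<Rightarrow> 'a::real_normed_field"
  shows "(\<Sum>\<alpha> | (\<Sum>i\<in>UNIV. \<alpha> i) = n. (\<Prod>i\<in>UNIV. x i ^ \<alpha> i) / of_real (da_weight \<alpha>)) = (\<Sum>i\<in>UNIV. x i) ^ n"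
proof -
  have "(\<Sum>\<alpha> | (\<Sum>i\<in>UNIV. \<alpha> i) = n. (\<Prod>i\<in>UNIV. x i ^ \<alpha> i) / of_real (da_weight \<alpha>)) =
     (\<Sum>\<alpha> | (\<Sum>i\<in>UNIV. \<alpha> i) = n. fact n * (\<Prod>i\<in>UNIV. x i ^ \<alpha> i / fact (\<alpha> i)))"
    by (rule sum.cong) (auto simp: da_weight_def prod_dividef)
  also have "\<dots> = (\<Sum>i\<in>UNIV. x i) ^ n"
    by (simp add: multinomial_fact flip: sum_distrib_left)
  finally show ?thesis .
qed

text \<open>
  The weights of the space are the reciprocals of the multinomial coefficients, so grouping the
  terms by degree gives the geometric series in \<open>\<Sum>\<^sub>i x i\<close>. The same computation with the moduli
  gives absolute convergence.
\<close>
lemma kernel_expansion: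
  fixes x :: "'d::finite \<Rightarrow> complex"
  assumes "(\<Sum>i\<in>UNIV. cmod (x i)) < 1"
  shows "((\<lambda>\<alpha>. (\<Prod>i\<in>UNIV. x i ^ \<alpha> i) / of_real (da_weight \<alpha>)) has_sum 1 / (1 - (\<Sum>i\<in>UNIV. x i))) UNIV"
proof -
  define D where "D n = {\<alpha> :: 'd \<Rightarrow> nat. (\<Sum>i\<in>UNIV. \<alpha> i) = n}" for n
  define F where "F \<alpha> = (\<Prod>i\<in>UNIV. x i ^ \<alpha> i) / of_real (da_weight \<alpha>)" for \<alpha>
  have fin: "finite (D n)" for n unfolding D_def by (rule finite_multi_indices_of_degree)
  have F: "((\<lambda>\<alpha>. F (snd (n, \<alpha>))) has_sum (\<Sum>i\<in>UNIV. x i) ^ n) (D n)" for n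
    using multinomial_da_weight[where n=n and x=x] by (intro has_sum_finiteI fin) (simp add: D_def F_def)
  have cmodF: "((\<lambda>\<alpha>. cmod (F (snd (n, \<alpha>)))) has_sum (\<Sum>i\<in>UNIV. cmod (x i)) ^ n) (D n)" for n
    using multinomial_da_weight[where n=n and x="\<lambda>i. cmod (x i)"]
    by (intro has_sum_finiteI fin)
       (simp add: D_def F_def norm_divide norm_power less_imp_le[OF da_weight_pos] flip: prod_norm)
  have geo: "summable (\<lambda>n. (\<Sum>i\<in>UNIV. cmod (x i)) ^ n)"
    using assms by (intro summable_geometric) (auto simp: sum_nonneg)
  have "cmod (\<Sum>i\<in>UNIV. x i) \<le> (\<Sum>i\<in>UNIV. cmod (x i))" by (rule norm_sum)
  then have lt: "cmod (\<Sum>i\<in>UNIV. x i) < 1" using assms by linarith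
  have "((\<lambda>n. (\<Sum>i\<in>UNIV. x i) ^ n) has_sum 1 / (1 - (\<Sum>i\<in>UNIV. x i))) UNIV"
    using lt by (intro norm_summable_imp_has_sum) (auto simp: norm_power intro: geometric_sums)
  moreover have "(\<lambda>p. F (snd p)) summable_on (SIGMA n:UNIV. D n)"
  proof (rule abs_summable_summable, rule summable_on_SigmaI[OF cmodF])
    show "(\<lambda>n. (\<Sum>i\<in>UNIV. cmod (x i)) ^ n) summable_on UNIV"
      using geo by (intro norm_summable_imp_summable_on) (simp add: norm_power sum_nonneg)
  qed auto
  ultimately have "((\<lambda>p. F (snd p)) has_sum 1 / (1 - (\<Sum>i\<in>UNIV. x i))) (SIGMA n:UNIV. D n)"
    using F by (intro has_sum_SigmaI) auto
  moreover have "inj_on snd (SIGMA n:UNIV. D n)" by (auto simp: inj_on_def D_def)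
  moreover have "snd ` (SIGMA n:UNIV. D n) = UNIV" by (force simp: D_def)
  ultimately have "(F has_sum 1 / (1 - (\<Sum>i\<in>UNIV. x i))) UNIV"
    by (metis (no_types, lifting) comp_def has_sum_cong has_sum_reindex)
  then show ?thesis by (simp add: F_def[abs_def])
qed

section \<open>Point evaluations and kernel energy\<close>

lemma Cauchy_Schwarz_has_sum:
  fixes c b :: "'i \<Rightarrow> complex"
  assumes w: "\<And>i. w i > 0"
    and S: "((\<lambda>i. c i * b i) has_sum S) UNIV"
    and A: "((\<lambda>i. w i * (cmod (c i))\<^sup>2) has_sum A) UNIV"
    and B: "((\<lambda>i. (cmod (b i))\<^sup>2 / w i) has_sum B) UNIV"
  shows "(cmod S)\<^sup>2 \<le> A * B"
proof -
  have "((\<lambda>F. (cmod (\<Sum>i\<in>F. c i * b i))\<^sup>2) \<longlongrightarrow> (cmod S)\<^sup>2) (finite_subsets_at_top UNIV)"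
    using S unfolding has_sum_def by (intro tendsto_intros)
  then show ?thesis
  proof (rule tendsto_upperbound)
    have "(cmod (\<Sum>i\<in>F. c i * b i))\<^sup>2 \<le> A * B" if F: "finite F" for F
    proof -
      have le: "cmod (c i * b i) \<le> (sqrt (w i) * cmod (c i)) * (cmod (b i) / sqrt (w i))" for i
        using w[of i] by (simp add: norm_mult)
      have "cmod (\<Sum>i\<in>F. c i * b i) \<le> (\<Sum>i\<in>F. (sqrt (w i) * cmod (c i)) * (cmod (b i) / sqrt (w i)))"
        by (intro sum_norm_le le)
      then have "(cmod (\<Sum>i\<in>F. c i * b i))\<^sup>2 \<le>
          (\<Sum>i\<in>F. (sqrt (w i) * cmod (c i)) * (cmod (b i) / sqrt (w i)))\<^sup>2"
        by (intro power_mono) auto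
      also have "\<dots> \<le> (\<Sum>i\<in>F. (sqrt (w i) * cmod (c i))\<^sup>2) * (\<Sum>i\<in>F. (cmod (b i) / sqrt (w i))\<^sup>2)"
        by (rule Cauchy_Schwarz_ineq_sum)
      also have "\<dots> = (\<Sum>i\<in>F. w i * (cmod (c i))\<^sup>2) * (\<Sum>i\<in>F. (cmod (b i))\<^sup>2 / w i)"
        using w by (simp add: power_mult_distrib power_divide less_imp_le)
      also have "\<dots> \<le> A * B"
      proof (intro mult_mono sum_nonneg)
        show "(\<Sum>i\<in>F. w i * (cmod (c i))\<^sup>2) \<le> A"
          using w by (intro finite_sum_le_has_sum[OF A F]) (auto simp: less_imp_le)
        show "(\<Sum>i\<in>F. (cmod (b i))\<^sup>2 / w i) \<le> B"
          using w by (intro finite_sum_le_has_sum[OF B F]) (auto simp: less_imp_le)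
        show "0 \<le> A"
          using w by (intro has_sum_nonneg[OF A]) (auto simp: less_imp_le)
      qed (use w in \<open>auto simp: less_imp_le\<close>)
      finally show ?thesis .
    qed
    then show "\<forall>\<^sub>F F in finite_subsets_at_top UNIV. (cmod (\<Sum>i\<in>F. c i * b i))\<^sup>2 \<le> A * B"
      by (intro eventually_finite_subsets_at_top_weakI) auto
  qed simp
qed

lemma has_sum_sum:
  fixes f :: "'j \<Rightarrow> 'i \<Rightarrow> complex"
  assumes "\<And>j. j \<in> J \<Longrightarrow> (f j has_sum s j) A"
  shows "((\<lambda>i. \<Sum>j\<in>J. f j i) has_sum (\<Sum>j\<in>J. s j)) A"
  using assms by (induction J rule: infinite_finite_induct) (auto intro: has_sum_add)

definition cinner_vec :: "complex ^ 'd \<Rightarrow> complex ^ 'd::finite \<Rightarrow> complex" where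
  "cinner_vec z w = (\<Sum>i\<in>UNIV. z $ i * cnj (w $ i))"

lemma Re_cinner_vec: "Re (cinner_vec z w) = z \<bullet> w"
  by (simp add: cinner_vec_def inner_vec_def inner_complex_def)

lemma monomial_kernel_expansion:
  fixes z w :: "complex ^ 'd::finite"
  assumes "norm z < 1" "norm w < 1"
  shows "((\<lambda>\<alpha>. multi_power z \<alpha> * cnj (multi_power w \<alpha>) / of_real (da_weight \<alpha>))
            has_sum 1 / (1 - cinner_vec z w)) UNIV"
proof -
  have "(\<Sum>i\<in>UNIV. cmod (z $ i * cnj (w $ i))) = (\<Sum>i\<in>UNIV. \<bar>cmod (z $ i)\<bar> * \<bar>cmod (w $ i)\<bar>)"
    by (simp add: norm_mult)
  also have "\<dots> \<le> norm z * norm w"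
    unfolding norm_vec_def by (rule L2_set_mult_ineq)
  also have "\<dots> < 1 * 1" using assms by (intro mult_strict_mono') auto
  finally have "(\<Sum>i\<in>UNIV. cmod (z $ i * cnj (w $ i))) < 1" by simp
  from kernel_expansion[OF this] show ?thesis
    by (simp add: multi_power_def cinner_vec_def power_mult_distrib prod.distrib)
qed

text \<open>
  The sum of the moduli is a sum \<open>\<Sum>\<^sub>j a j * g (w j)\<close> with unimodular (or zero) coefficients \<open>a j\<close>,
  hence the pairing of the Taylor coefficients of \<open>g\<close> with \<open>\<Sum>\<^sub>j a j * w j\<^sup>\<alpha>\<close>. The Cauchy-Schwarz
  inequality bounds its square by the squared norm of \<open>g\<close> times the squared norm of the linear
  combination of the reproducing kernels at the \<open>w j\<close> with the coefficients \<open>cnj (a j)\<close>, which is the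
  double sum of the kernel values with coefficients \<open>a j * cnj (a k)\<close>.
\<close>
lemma evaluation_energy_bound:
  fixes w :: "'j \<Rightarrow> complex ^ 'd::finite"
  assumes g: "g \<in> drury_arveson" and J: "finite J" and w: "\<And>j. j \<in> J \<Longrightarrow> norm (w j) < 1"
  shows "(\<Sum>j\<in>J. cmod (g (w j)))\<^sup>2 \<le>
     (da_norm g)\<^sup>2 * (\<Sum>j\<in>J. \<Sum>k\<in>J. 1 / cmod (1 - cinner_vec (w j) (w k)))"
proof -
  define a where "a j = cnj (sgn (g (w j)))" for j
  define E where "E = (\<Sum>j\<in>J. \<Sum>k\<in>J. a j * cnj (a k) * (1 / (1 - cinner_vec (w j) (w k))))"
  define b where "b \<alpha> = (\<Sum>j\<in>J. a j * multi_power (w j) \<alpha>)" for \<alpha>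
  have a: "cmod (a j) \<le> 1" "a j * g (w j) = cmod (g (w j))" for j
    unfolding a_def
    by (auto simp: norm_sgn)
      (simp add: sgn_div_norm scaleR_conv_of_real divide_simps power2_eq_square mult.commute flip: complex_norm_square of_real_mult)
  have "((\<lambda>\<alpha>. \<Sum>j\<in>J. a j * (taylor_coeff g \<alpha> * multi_power (w j) \<alpha>)) has_sum (\<Sum>j\<in>J. a j * g (w j))) UNIV"
    using power_expansion_taylor_coeff[OF g] w
    by (intro has_sum_sum has_sum_cmult_right) (auto simp: power_expansion_def)
  then have S: "((\<lambda>\<alpha>. taylor_coeff g \<alpha> * b \<alpha>) has_sum of_real (\<Sum>j\<in>J. cmod (g (w j)))) UNIV"
    by (simp add: b_def a sum_distrib_left mult_ac)
  have A: "((\<lambda>\<alpha>. da_weight \<alpha> * (cmod (taylor_coeff g \<alpha>))\<^sup>2) has_sum (da_norm g)\<^sup>2) UNIV"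
    using g by (simp add: drury_arveson_def da_norm_def infsum_nonneg less_imp_le[OF da_weight_pos])
  have "((\<lambda>\<alpha>. \<Sum>j\<in>J. \<Sum>k\<in>J. a j * cnj (a k) *
         (multi_power (w j) \<alpha> * cnj (multi_power (w k) \<alpha>) / of_real (da_weight \<alpha>))) has_sum E) UNIV"
    unfolding E_def by (intro has_sum_sum has_sum_cmult_right monomial_kernel_expansion w) auto
  moreover have "(\<Sum>j\<in>J. \<Sum>k\<in>J. a j * cnj (a k) *
         (multi_power (w j) \<alpha> * cnj (multi_power (w k) \<alpha>) / of_real (da_weight \<alpha>)))
      = complex_of_real ((cmod (b \<alpha>))\<^sup>2 / da_weight \<alpha>)" for \<alpha>
    unfolding of_real_divide complex_norm_square b_def
    by (simp add: sum_product sum_divide_distrib mult_ac)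
  ultimately have "((\<lambda>\<alpha>. complex_of_real ((cmod (b \<alpha>))\<^sup>2 / da_weight \<alpha>)) has_sum E) UNIV" by simp
  then have B: "((\<lambda>\<alpha>. (cmod (b \<alpha>))\<^sup>2 / da_weight \<alpha>) has_sum Re E) UNIV"
    using has_sum_Re by fastforce
  have "(\<Sum>j\<in>J. cmod (g (w j)))\<^sup>2 = (cmod (complex_of_real (\<Sum>j\<in>J. cmod (g (w j)))))\<^sup>2"
    by (simp only: norm_of_real power2_abs)
  also have "\<dots> \<le> (da_norm g)\<^sup>2 * Re E"
    by (rule Cauchy_Schwarz_has_sum[OF da_weight_pos S A B])
  also have "Re E \<le> cmod E" by (rule complex_Re_le_cmod)
  also have "cmod E \<le> (\<Sum>j\<in>J. \<Sum>k\<in>J. 1 / cmod (1 - cinner_vec (w j) (w k)))"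
    unfolding E_def
  proof (intro sum_norm_le)
    fix j k
    have "cmod (a j) * cmod (a k) \<le> 1" by (intro mult_le_one a) auto
    then show "cmod (a j * cnj (a k) * (1 / (1 - cinner_vec (w j) (w k)))) \<le> 1 / cmod (1 - cinner_vec (w j) (w k))"
      by (simp add: norm_mult norm_divide divide_right_mono)
  qed
  finally show ?thesis by (simp add: mult_left_mono)
qed

section \<open>Discrete energy in three dimensions\<close>

definition sqnorm3 :: "int \<times> int \<times> int \<Rightarrow> real" where
  "sqnorm3 = (\<lambda>(a, b, c). (of_int a)\<^sup>2 + (of_int b)\<^sup>2 + (of_int c)\<^sup>2)"

text \<open>
  The shell of integer points whose largest coordinate has modulus \<open>n\<close> contains
  \<open>(2 n + 1)\<^sup>3 - (2 n - 1)\<^sup>3 = 24 n\<^sup>2 + 2\<close> points, each with a summand of at most \<open>1 / (1 + n\<^sup>2)\<close>. So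
  every shell contributes at most a constant. This is where dimension three is decisive: two
  dimensions would give shells of order \<open>1 / n\<close> and a logarithm in the normalized energy of a grid.
\<close>
lemma lattice_cube_energy:
  fixes N :: nat
  defines "K \<equiv> \<lambda>N::nat. {-int N..int N} \<times> {-int N..int N} \<times> {-int N..int N}"
  shows "(\<Sum>l\<in>K N. 1 / (1 + sqnorm3 l)) \<le> 1 + 26 * real N"
proof (induction N)
  case 0
  have "K 0 = {(0, 0, 0)}" by (auto simp: K_def)
  then show ?case by (simp add: sqnorm3_def)
next
  case (Suc N)
  have fin: "finite (K n)" for n by (simp add: K_def)
  have sub: "K N \<subseteq> K (Suc N)" by (auto simp: K_def)
  have card_K: "card (K n) = (2 * n + 1) ^ 3" for n
  proof -
    have "nat (int n - - int n + 1) = 2 * n + 1" by linarith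
    then show ?thesis by (simp add: K_def card_cartesian_product power3_eq_cube)
  qed
  have "real (card (K (Suc N) - K N)) = real ((2 * Suc N + 1) ^ 3) - real ((2 * N + 1) ^ 3)"
    using card_mono[OF fin sub] by (simp add: card_Diff_subset[OF fin sub] card_K)
  also have "\<dots> = 24 * (real (Suc N))\<^sup>2 + 2"
    by (simp add: power3_eq_cube power2_eq_square algebra_simps)
  finally have card: "real (card (K (Suc N) - K N)) = 24 * (real (Suc N))\<^sup>2 + 2" .
  have far: "(real (Suc N))\<^sup>2 \<le> sqnorm3 l" if "l \<in> K (Suc N) - K N" for l
  proof -
    obtain a b c where l: "l = (a, b, c)" by (cases l)
    have "\<bar>a\<bar> = int (Suc N) \<or> \<bar>b\<bar> = int (Suc N) \<or> \<bar>c\<bar> = int (Suc N)"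
      using that by (auto simp: l K_def)
    moreover have "(of_int t)\<^sup>2 = (real (Suc N))\<^sup>2" if "\<bar>t\<bar> = int (Suc N)" for t
    proof -
      have "\<bar>real_of_int t\<bar> = real (Suc N)" unfolding of_int_abs[symmetric] that by simp
      then show ?thesis by (metis power2_abs)
    qed
    ultimately have "(of_int a)\<^sup>2 = (real (Suc N))\<^sup>2 \<or> (of_int b)\<^sup>2 = (real (Suc N))\<^sup>2 \<or> (of_int c)\<^sup>2 = (real (Suc N))\<^sup>2"
      by blast
    then show ?thesis unfolding l sqnorm3_def prod.case
      by (elim disjE) (simp_all del: of_nat_Suc)
  qed
  have "(\<Sum>l\<in>K (Suc N) - K N. 1 / (1 + sqnorm3 l)) \<le>
      real (card (K (Suc N) - K N)) * (1 / (1 + (real (Suc N))\<^sup>2))"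
    by (intro sum_bounded_above frac_le add_left_mono far) (auto intro: add_pos_nonneg simp del: of_nat_Suc)
  also have "\<dots> \<le> 26"
    unfolding card by (simp add: divide_simps add_pos_nonneg)
  finally show ?case
    using Suc.IH sum.subset_diff[OF sub fin, of "\<lambda>l. 1 / (1 + sqnorm3 l)"] by simp
qed

text \<open>
  The differences \<open>j - k\<close> with \<open>j\<close> fixed are distinct points of the cube of the preceding lemma.
\<close>
lemma grid_energy:
  fixes N :: nat
  defines "G \<equiv> {0..<int N} \<times> {0..<int N} \<times> {0..<int N}"
  shows "(\<Sum>j\<in>G. \<Sum>k\<in>G. 1 / (1 + sqnorm3 (j - k))) \<le> 27 * real N ^ 4"
proof (cases "N = 0")
  case False
  define K where "K = {-int N..int N} \<times> {-int N..int N} \<times> {-int N..int N}"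
  have "(\<Sum>k\<in>G. 1 / (1 + sqnorm3 (j - k))) \<le> 27 * real N" if j: "j \<in> G" for j
  proof -
    have "(\<Sum>k\<in>G. 1 / (1 + sqnorm3 (j - k))) = (\<Sum>l\<in>(\<lambda>k. j - k) ` G. 1 / (1 + sqnorm3 l))"
      by (subst sum.reindex) (auto simp: inj_on_def)
    also have "\<dots> \<le> (\<Sum>l\<in>K. 1 / (1 + sqnorm3 l))"
      by (rule sum_mono2) (use j in \<open>auto simp: K_def G_def sqnorm3_def\<close>)
    also have "\<dots> \<le> 1 + 26 * real N" unfolding K_def by (rule lattice_cube_energy)
    also have "\<dots> \<le> 27 * real N" using False by simp
    finally show ?thesis .
  qed
  then have "(\<Sum>j\<in>G. \<Sum>k\<in>G. 1 / (1 + sqnorm3 (j - k))) \<le> real (card G) * (27 * real N)"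
    by (rule sum_bounded_above)
  also have "\<dots> = 27 * real N ^ 4" by (simp add: G_def card_cartesian_product power4_eq_xxxx)
  finally show ?thesis .
qed (simp add: G_def)

section \<open>Local distortion by a diffeomorphism\<close>

text \<open>
  On a compact ball in \<open>U\<close> the finitely many partial derivatives are bounded, hence so is the operator
  norm of the derivative, and the mean value inequality applies.
\<close>
lemma C1_locally_Lipschitz:
  fixes g :: "'a::euclidean_space \<Rightarrow> 'b::real_normed_vector"
  assumes C1: "Ck_on (Suc 0) U g" and U: "open U" "p \<in> U"
  obtains r L where "r > 0" "\<And>x y. x \<in> ball p r \<Longrightarrow> y \<in> ball p r \<Longrightarrow> norm (g x - g y) \<le> L * norm (x - y)"
proof -
  obtain r where r: "r > 0" "cball p r \<subseteq> U" using U open_contains_cball by blast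
  let ?D = "\<lambda>x. frechet_derivative g (at x)"
  have der: "(g has_derivative ?D x) (at x)" if "x \<in> cball p r" for x
    using C1 r that by (auto simp flip: frechet_derivative_works)
  have "\<exists>B. \<forall>x\<in>cball p r. norm (?D x b) \<le> B" for b
  proof -
    have "continuous_on (cball p r) (\<lambda>x. ?D x b)"
      using C1 by (intro continuous_on_subset[OF _ r(2)]) auto
    then have "bounded ((\<lambda>x. ?D x b) ` cball p r)"
      by (intro compact_imp_bounded compact_continuous_image) auto
    then show ?thesis by (auto simp: bounded_iff)
  qed
  then obtain B where B: "\<And>x b. x \<in> cball p r \<Longrightarrow> norm (?D x b) \<le> B b" by metis
  have onorm: "onorm (?D x) \<le> (\<Sum>b\<in>Basis. B b)" if x: "x \<in> cball p r" for x
  proof (rule onorm_le)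
    fix v
    interpret D: bounded_linear "?D x" using der[OF x] by (rule has_derivative_bounded_linear)
    have "?D x v = ?D x (\<Sum>b\<in>Basis. (v \<bullet> b) *\<^sub>R b)" by (simp add: euclidean_representation)
    also have "\<dots> = (\<Sum>b\<in>Basis. (v \<bullet> b) *\<^sub>R ?D x b)" by (simp add: D.sum D.scaleR)
    also have "norm \<dots> \<le> (\<Sum>b\<in>Basis. norm v * B b)"
      using B[OF x] Basis_le_norm by (intro sum_norm_le) (auto intro!: mult_mono)
    finally show "norm (?D x v) \<le> (\<Sum>b\<in>Basis. B b) * norm v"
      by (simp add: sum_distrib_left mult.commute)
  qed
  show ?thesis
  proof (rule that[OF r(1)])
    fix x y assume "x \<in> ball p r" "y \<in> ball p r"
    then show "norm (g x - g y) \<le> (\<Sum>b\<in>Basis. B b) * norm (x - y)"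
      using onorm der
      by (intro differentiable_bound[of "ball p r" g ?D]) (auto intro: has_derivative_at_withinI)
  qed
qed

text \<open>
  Near \<open>\<phi> p\<close> the inverse of \<open>\<phi>\<close> is the restriction of a smooth, hence locally Lipschitz, map, and the
  Lipschitz inequality of the inverse is the expansion inequality of \<open>\<phi>\<close>.
\<close>
lemma diffeomorphism_locally_expanding:
  fixes \<phi> :: "'a::euclidean_space \<Rightarrow> 'b::euclidean_space"
  assumes \<phi>: "diffeomorphism_between S T \<phi>" and p: "p \<in> S"
  obtains e L where "e > 0" "L > 0"
    "\<And>x y. x \<in> S \<inter> ball p e \<Longrightarrow> y \<in> S \<inter> ball p e \<Longrightarrow> norm (x - y) \<le> L * norm (\<phi> x - \<phi> y)"
proof -
  have bij: "bij_betw \<phi> S T" and sm: "smooth_map_on S \<phi>" and smi: "smooth_map_on T (inv_into S \<phi>)"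
    using \<phi> by (auto simp: diffeomorphism_between_def)
  have "\<phi> p \<in> T" using bij p by (auto simp: bij_betw_def)
  with smi obtain U g where U: "open U" "\<phi> p \<in> U" and g: "Ck_on (Suc 0) U g"
    and ginv: "\<And>y. y \<in> T \<inter> U \<Longrightarrow> g y = inv_into S \<phi> y"
    unfolding smooth_map_on_def by metis
  obtain r L where r: "r > 0"
    and L: "\<And>x y. x \<in> ball (\<phi> p) r \<Longrightarrow> y \<in> ball (\<phi> p) r \<Longrightarrow> norm (g x - g y) \<le> L * norm (x - y)"
    by (rule C1_locally_Lipschitz[OF g U]) blast
  from sm p obtain V h where V: "open V" "p \<in> V" and h: "Ck_on 0 V h"
    and heq: "\<And>y. y \<in> S \<inter> V \<Longrightarrow> h y = \<phi> y"
    unfolding smooth_map_on_def by metis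
  define W where "W = V \<inter> h -` (ball (\<phi> p) r \<inter> U)"
  have "open W"
    unfolding W_def using h V U by (intro continuous_open_preimage) auto
  moreover have "p \<in> W" using V U r p heq[of p] by (auto simp: W_def)
  ultimately obtain e where e: "e > 0" "ball p e \<subseteq> W" by (meson openE)
  show ?thesis
  proof (rule that[OF e(1), of "max L 1"])
    fix x y assume xy: "x \<in> S \<inter> ball p e" "y \<in> S \<inter> ball p e"
    have *: "\<phi> z \<in> ball (\<phi> p) r" "g (\<phi> z) = z" if "z \<in> S \<inter> ball p e" for z
    proof -
      have z: "z \<in> S" "z \<in> V" "h z \<in> ball (\<phi> p) r" "h z \<in> U"
        using that e by (auto simp: W_def)
      then show "\<phi> z \<in> ball (\<phi> p) r" using heq by auto
      have "\<phi> z \<in> T \<inter> U" using z heq bij by (auto simp: bij_betw_def)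
      then show "g (\<phi> z) = z" using ginv z bij by (simp add: bij_betw_def)
    qed
    have "norm (x - y) \<le> L * norm (\<phi> x - \<phi> y)"
      using L[of "\<phi> x" "\<phi> y"] *[OF xy(1)] *[OF xy(2)] by simp
    also have "\<dots> \<le> max L 1 * norm (\<phi> x - \<phi> y)" by (intro mult_right_mono) auto
    finally show "norm (x - y) \<le> max L 1 * norm (\<phi> x - \<phi> y)" .
  qed auto
qed

section \<open>Bounded energy on the zero set\<close>

text \<open>
  If \<open>f\<close> is cyclic, then \<open>1 - \<psi> f\<close> has small norm for some multiplier \<open>\<psi>\<close>, which lies in the
  space because \<open>1\<close> does. At the points \<open>r z\<^sub>j\<close> the mean of \<open>|1 - \<psi> f|\<close> is small by the
  energy bound. The mean of \<open>|\<psi> f|\<close> is at most the maximum of \<open>|f|\<close> at these points, which tends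
  to \<open>0\<close> as \<open>r\<close> tends to \<open>1\<close>, times the mean of \<open>|\<psi>|\<close>, which is bounded again by the energy
  bound. But \<open>1 = (1 - \<psi> f) + \<psi> f\<close> has mean \<open>1\<close>. The set \<open>J\<close> and the points may depend on \<open>r\<close>,
  since only their energy, and not a limiting measure, enters.
\<close>
lemma not_cyclic_of_bounded_energy:
  fixes f :: "complex ^ 'd::finite \<Rightarrow> complex"
  assumes f: "f \<in> drury_arveson" and cont: "continuous_on (cball 0 1) f"
    and energy: "\<And>r0. r0 < 1 \<Longrightarrow> \<exists>r J (z :: 'j \<Rightarrow> complex ^ 'd). r0 < r \<and> 0 < r \<and> r < 1 \<and> finite J \<and> J \<noteq> {} \<and>
       z ` J \<subseteq> zero_set f \<inter> sphere 0 1 \<and>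
       (\<Sum>j\<in>J. \<Sum>k\<in>J. 1 / cmod (1 - cinner_vec (r *\<^sub>R z j) (r *\<^sub>R z k))) \<le> C * (real (card J))\<^sup>2"
  shows "\<not> da_cyclic f"
proof
  assume "da_cyclic f"
  then have cl: "(\<lambda>_. 1) \<in> da_closure ((\<lambda>\<psi> z. \<psi> z * f z) ` da_multipliers)"
    using one_in_drury_arveson by (auto simp: da_cyclic_def)
  define D where "D = sqrt (max C 1)"
  have D: "D > 0" by (simp add: D_def)
  \<comment> \<open>The constants \<open>\<epsilon>\<close> and \<open>\<eta>\<close> make each of the two means at most \<open>1/4\<close>.\<close>
  define \<epsilon> where "\<epsilon> = 1 / (4 * D)"
  have "\<epsilon> > 0" using D by (simp add: \<epsilon>_def)
  with cl obtain \<psi> where \<psi>: "\<psi> \<in> da_multipliers" and close: "da_norm (\<lambda>z. 1 - \<psi> z * f z) < \<epsilon>"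
    by (auto simp: da_closure_def)
  have g: "(\<lambda>z. 1 - \<psi> z * f z) \<in> drury_arveson"
    using \<psi> f by (intro drury_arveson_diff one_in_drury_arveson) (auto simp: da_multipliers_def)
  have "(\<lambda>z. \<psi> z * 1) \<in> drury_arveson"
    using bspec[OF \<psi>[unfolded da_multipliers_def mem_Collect_eq] one_in_drury_arveson] .
  then have \<psi>DA: "\<psi> \<in> drury_arveson" by simp
  have norm_nonneg: "da_norm h \<ge> 0" for h :: "complex ^ 'd \<Rightarrow> complex"
    by (auto simp: da_norm_def intro!: infsum_nonneg mult_nonneg_nonneg less_imp_le[OF da_weight_pos])
  define \<eta> where "\<eta> = 1 / (4 * (D * da_norm \<psi> + 1))"
  have "\<eta> > 0" using D norm_nonneg[of \<psi>] by (simp add: \<eta>_def add_nonneg_pos)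
  have "uniformly_continuous_on (cball 0 1) f"
    using cont by (intro compact_uniformly_continuous) auto
  then obtain \<delta> where \<delta>: "\<delta> > 0"
    and unif: "\<And>x y. x \<in> cball 0 1 \<Longrightarrow> y \<in> cball 0 1 \<Longrightarrow> dist y x < \<delta> \<Longrightarrow> dist (f y) (f x) < \<eta>"
    using \<open>\<eta> > 0\<close> unfolding uniformly_continuous_on_def by metis
  obtain r J and z :: "'j \<Rightarrow> complex ^ 'd" where r: "1 - \<delta> < r" "0 < r" "r < 1"
    and J: "finite J" "J \<noteq> {}" and z: "z ` J \<subseteq> zero_set f \<inter> sphere 0 1"
    and E: "(\<Sum>j\<in>J. \<Sum>k\<in>J. 1 / cmod (1 - cinner_vec (r *\<^sub>R z j) (r *\<^sub>R z k))) \<le> C * (real (card J))\<^sup>2"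
    using energy[of "1 - \<delta>"] \<delta> by auto
  have z1: "norm (z j) = 1" "f (z j) = 0" if "j \<in> J" for j
    using z that by (auto simp: zero_set_def)
  have small: "cmod (f (r *\<^sub>R z j)) \<le> \<eta>" if "j \<in> J" for j
  proof -
    have "r *\<^sub>R z j - z j = (r - 1) *\<^sub>R z j" by (simp add: algebra_simps)
    then have "dist (r *\<^sub>R z j) (z j) < \<delta>" using r z1[OF that] by (simp add: dist_norm)
    then have "dist (f (r *\<^sub>R z j)) (f (z j)) < \<eta>"
      using r z1[OF that] by (intro unif) auto
    then show ?thesis using z1[OF that] by (simp add: less_imp_le)
  qed
  have mean: "(\<Sum>j\<in>J. cmod (h (r *\<^sub>R z j))) \<le> da_norm h * D * card J" if h: "h \<in> drury_arveson" for h
  proof -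
    have "(\<Sum>j\<in>J. cmod (h (r *\<^sub>R z j)))\<^sup>2 \<le>
        (da_norm h)\<^sup>2 * (\<Sum>j\<in>J. \<Sum>k\<in>J. 1 / cmod (1 - cinner_vec (r *\<^sub>R z j) (r *\<^sub>R z k)))"
      using r z1 by (intro evaluation_energy_bound h J) auto
    also have "\<dots> \<le> (da_norm h)\<^sup>2 * (max C 1 * (real (card J))\<^sup>2)"
      by (intro mult_left_mono order.trans[OF E] mult_right_mono) auto
    also have "\<dots> = (da_norm h * D * card J)\<^sup>2" by (simp add: D_def power_mult_distrib)
    finally show ?thesis
      by (rule power2_le_imp_le) (use norm_nonneg[of h] D in auto)
  qed
  have "real (card J) = (\<Sum>j\<in>J. cmod ((1 - \<psi> (r *\<^sub>R z j) * f (r *\<^sub>R z j)) + \<psi> (r *\<^sub>R z j) * f (r *\<^sub>R z j)))"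
    by simp
  also have "\<dots> \<le> (\<Sum>j\<in>J. cmod (1 - \<psi> (r *\<^sub>R z j) * f (r *\<^sub>R z j)) + \<eta> * cmod (\<psi> (r *\<^sub>R z j)))"
  proof (intro sum_mono norm_triangle_le add_left_mono)
    fix j assume "j \<in> J"
    then show "cmod (\<psi> (r *\<^sub>R z j) * f (r *\<^sub>R z j)) \<le> \<eta> * cmod (\<psi> (r *\<^sub>R z j))"
      unfolding norm_mult by (subst mult.commute) (intro mult_right_mono small, auto)
  qed
  also have "\<dots> \<le> da_norm (\<lambda>z. 1 - \<psi> z * f z) * D * card J + \<eta> * (da_norm \<psi> * D * card J)"
    unfolding sum.distrib sum_distrib_left[symmetric]
    using mean[OF g] mean[OF \<psi>DA] \<open>\<eta> > 0\<close> by (intro add_mono mult_left_mono) auto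
  also have "\<dots> \<le> (1/4) * card J + (1/4) * card J"
  proof (intro add_mono)
    have "da_norm (\<lambda>z. 1 - \<psi> z * f z) * D \<le> \<epsilon> * D" using close D by simp
    also have "\<dots> = 1/4" using D by (simp add: \<epsilon>_def)
    finally show "da_norm (\<lambda>z. 1 - \<psi> z * f z) * D * card J \<le> (1/4) * card J"
      by (intro mult_right_mono) auto
    have "\<eta> * (da_norm \<psi> * D) \<le> 1/4"
      using D norm_nonneg[of \<psi>] by (simp add: \<eta>_def divide_simps add_nonneg_pos mult.commute)
    then have "\<eta> * (da_norm \<psi> * D) * card J \<le> (1/4) * card J" by (intro mult_right_mono) auto
    then show "\<eta> * (da_norm \<psi> * D * card J) \<le> (1/4) * card J" by (simp only: mult.assoc)
  qed
  finally show False using J by (simp add: card_gt_0_iff)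
qed

section \<open>Grids in embedded cubes\<close>

lemma Re_kernel_sphere:
  fixes z w :: "complex ^ 'd::finite"
  assumes "norm z = 1" "norm w = 1"
  shows "Re (1 - cinner_vec (r *\<^sub>R z) (r *\<^sub>R w)) = (1 - r\<^sup>2) + r\<^sup>2 * (norm (z - w))\<^sup>2 / 2"
proof -
  have "(norm (z - w))\<^sup>2 = 2 - 2 * (z \<bullet> w)"
    using assms dot_square_norm[of z] dot_square_norm[of w] inner_commute[of w z]
    by (simp add: power2_norm_eq_inner inner_diff_left inner_diff_right)
  then have inner: "z \<bullet> w = 1 - (norm (z - w))\<^sup>2 / 2" by linarith
  have "Re (1 - cinner_vec (r *\<^sub>R z) (r *\<^sub>R w)) = 1 - r\<^sup>2 * (z \<bullet> w)"
    by (simp add: Re_cinner_vec power2_eq_square)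
  also have "\<dots> = (1 - r\<^sup>2) + r\<^sup>2 * (norm (z - w))\<^sup>2 / 2"
    unfolding inner by (simp add: algebra_simps)
  finally show ?thesis .
qed

text \<open>
  By the preceding lemma, the kernel at two points is controlled by the reciprocal of
  \<open>1 - r\<^sup>2\<close> plus a multiple of their squared distance. If the grid is so fine that its squared mesh
  \<open>1 / N\<^sup>2\<close> is at most \<open>1 - r\<^sup>2\<close>, this is at most a multiple of \<open>N\<^sup>2 / (1 + |j - k|\<^sup>2)\<close>, also on
  the diagonal, and the sum over the grid is of order \<open>N\<^sup>2 * N\<^sup>4\<close>, the square of the number of points.
\<close>
lemma spherical_grid_energy:
  fixes N :: nat and z :: "int \<times> int \<times> int \<Rightarrow> complex ^ 'd::finite"
  defines "G \<equiv> {0..<int N} \<times> {0..<int N} \<times> {0..<int N}"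
  assumes N: "N > 0" and z: "\<And>j. j \<in> G \<Longrightarrow> norm (z j) = 1"
    and sep: "\<And>j k. j \<in> G \<Longrightarrow> k \<in> G \<Longrightarrow> s\<^sup>2 * sqnorm3 (j - k) \<le> (real N)\<^sup>2 * (norm (z j - z k))\<^sup>2"
    and r: "1 / 2 \<le> r\<^sup>2" "1 / (real N)\<^sup>2 \<le> 1 - r\<^sup>2"
    and \<kappa>: "0 < \<kappa>" "\<kappa> \<le> 1" "\<kappa> \<le> s\<^sup>2 / 4"
  shows "(\<Sum>j\<in>G. \<Sum>k\<in>G. 1 / cmod (1 - cinner_vec (r *\<^sub>R z j) (r *\<^sub>R z k))) \<le> 27 / \<kappa> * (real (card G))\<^sup>2"
proof -
  have Q: "sqnorm3 l \<ge> 0" for l by (auto simp: sqnorm3_def split: prod.split)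
  have "1 / cmod (1 - cinner_vec (r *\<^sub>R z j) (r *\<^sub>R z k)) \<le> (real N)\<^sup>2 / \<kappa> * (1 / (1 + sqnorm3 (j - k)))"
    if jk: "j \<in> G" "k \<in> G" for j k
  proof -
    have "\<kappa> * (1 + sqnorm3 (j - k)) \<le> 1 + s\<^sup>2 / 4 * sqnorm3 (j - k)"
      unfolding distrib_left using \<kappa> Q[of "j - k"] by (intro add_mono mult_right_mono) auto
    also have "\<dots> \<le> 1 + (real N)\<^sup>2 * (norm (z j - z k))\<^sup>2 / 4" using sep[OF jk] by simp
    finally have "\<kappa> * (1 + sqnorm3 (j - k)) / (real N)\<^sup>2 \<le>
        (1 + (real N)\<^sup>2 * (norm (z j - z k))\<^sup>2 / 4) / (real N)\<^sup>2"
      by (intro divide_right_mono) auto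
    also have "\<dots> = 1 / (real N)\<^sup>2 + (norm (z j - z k))\<^sup>2 / 4"
      using N by (simp add: add_divide_distrib)
    also have "\<dots> \<le> (1 - r\<^sup>2) + r\<^sup>2 * (norm (z j - z k))\<^sup>2 / 2"
      using mult_right_mono[OF r(1), of "(norm (z j - z k))\<^sup>2"] r(2) by simp
    also have "\<dots> = Re (1 - cinner_vec (r *\<^sub>R z j) (r *\<^sub>R z k))"
      using z jk by (simp only: Re_kernel_sphere)
    also have "\<dots> \<le> cmod (1 - cinner_vec (r *\<^sub>R z j) (r *\<^sub>R z k))" by (rule complex_Re_le_cmod)
    finally have *: "\<kappa> * (1 + sqnorm3 (j - k)) / (real N)\<^sup>2 \<le> cmod (1 - cinner_vec (r *\<^sub>R z j) (r *\<^sub>R z k))" .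
    have "0 < \<kappa> * (1 + sqnorm3 (j - k)) / (real N)\<^sup>2"
      using \<kappa> N Q[of "j - k"] by (intro divide_pos_pos mult_pos_pos) auto
    from divide_left_mono[OF * zero_le_one mult_pos_pos[OF less_le_trans[OF this *] this]]
    show ?thesis by simp
  qed
  then have "(\<Sum>j\<in>G. \<Sum>k\<in>G. 1 / cmod (1 - cinner_vec (r *\<^sub>R z j) (r *\<^sub>R z k)))
      \<le> (\<Sum>j\<in>G. \<Sum>k\<in>G. (real N)\<^sup>2 / \<kappa> * (1 / (1 + sqnorm3 (j - k))))"
    by (intro sum_mono)
  also have "\<dots> = (real N)\<^sup>2 / \<kappa> * (\<Sum>j\<in>G. \<Sum>k\<in>G. 1 / (1 + sqnorm3 (j - k)))"
    by (simp only: sum_distrib_left)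
  also have "\<dots> \<le> (real N)\<^sup>2 / \<kappa> * (27 * real N ^ 4)"
    unfolding G_def using \<kappa> by (intro mult_left_mono grid_energy) auto
  also have "\<dots> = 27 / \<kappa> * (real (card G))\<^sup>2"
    by (simp add: G_def card_cartesian_product power4_eq_xxxx power2_eq_square)
  finally show ?thesis .
qed

definition grid_point :: "'m \<Rightarrow> 'm \<Rightarrow> 'm \<Rightarrow> real \<Rightarrow> int \<times> int \<times> int \<Rightarrow> real ^ 'm::finite" where
  "grid_point a b c h = (\<lambda>(j1, j2, j3). \<chi> i.
     h * of_int (if i = a then j1 else if i = b then j2 else if i = c then j3 else 0))"

lemma grid_point_separation:
  assumes "a \<noteq> b" "a \<noteq> c" "b \<noteq> c"
  shows "h\<^sup>2 * sqnorm3 (j - k) \<le> (norm (grid_point a b c h j - grid_point a b c h k))\<^sup>2"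
proof -
  define v where "v = grid_point a b c h j - grid_point a b c h k"
  obtain j1 j2 j3 k1 k2 k3 where jk: "j = (j1, j2, j3)" "k = (k1, k2, k3)" by (metis prod.exhaust)
  have "h\<^sup>2 * sqnorm3 (j - k) = (\<Sum>i\<in>{a, b, c}. (v $ i)\<^sup>2)"
    using assms by (simp add: v_def jk grid_point_def sqnorm3_def power2_eq_square algebra_simps)
  also have "\<dots> \<le> (\<Sum>i\<in>UNIV. (v $ i)\<^sup>2)" by (rule sum_mono2) auto
  also have "\<dots> = (norm v)\<^sup>2" by (simp add: norm_vec_def L2_set_def sum_nonneg)
  finally show ?thesis by (simp add: v_def)
qed

theorem theorem4p8:
  fixes f :: "complex ^ 'd::finite \<Rightarrow> complex"
  assumes "f \<in> drury_arveson"
    and "continuous_on (cball 0 1) f"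
    and "CARD('m::finite) \<ge> 3"
    and "contains_embedded_cube TYPE('m) (zero_set f \<inter> sphere 0 1)"
  shows "\<not> da_cyclic f"
proof -
  obtain \<phi> :: "real ^ 'm \<Rightarrow> complex ^ 'd"
    where \<phi>: "\<phi> ` open_cube \<subseteq> zero_set f \<inter> sphere 0 1"
      and diffeo: "diffeomorphism_between open_cube (\<phi> ` open_cube) \<phi>"
    using assms(4) by (auto simp: contains_embedded_cube_def)
  have "(0 :: real ^ 'm) \<in> open_cube" by (simp add: open_cube_def)
  from diffeomorphism_locally_expanding[OF diffeo this] obtain e L where e: "e > 0" and L: "L > 0"
    and expand: "\<And>x y. x \<in> open_cube \<inter> ball 0 e \<Longrightarrow> y \<in> open_cube \<inter> ball 0 e \<Longrightarrow>
        norm (x - y) \<le> L * norm (\<phi> x - \<phi> y)" by blast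
  obtain A :: "'m set" where "card A = 3" using assms(3) obtain_subset_with_card_n by blast
  then obtain a b c :: 'm where abc: "a \<noteq> b" "a \<noteq> c" "b \<noteq> c" by (auto simp: card_3_iff)
  \<comment> \<open>A grid with coordinates in \<open>[0, \<delta>)\<close> stays in the cube and in the ball of radius \<open>e\<close>.\<close>
  define \<delta> where "\<delta> = min (1 / 2) (e / (2 * CARD('m)))"
  have \<delta>: "0 < \<delta>" "\<delta> < 1" "CARD('m) * \<delta> < e"
  proof -
    have "CARD('m) * \<delta> \<le> CARD('m) * (e / (2 * CARD('m)))" by (intro mult_left_mono) (auto simp: \<delta>_def)
    also have "\<dots> < e" using e by simp
    finally show "CARD('m) * \<delta> < e" .
  qed (use e in \<open>auto simp: \<delta>_def\<close>)
  \<comment> \<open>Grid points with index difference \<open>l\<close> have images at distance at least \<open>s |l| / N\<close>.\<close>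
  define s where "s = \<delta> / L"
  define \<kappa> where "\<kappa> = min 1 (s\<^sup>2 / 4)"
  have \<kappa>: "0 < \<kappa>" "\<kappa> \<le> 1" "\<kappa> \<le> s\<^sup>2 / 4" using \<delta> L by (auto simp: \<kappa>_def s_def)
  show ?thesis
  proof (rule not_cyclic_of_bounded_energy[OF assms(1,2)])
    fix r0 :: real assume "r0 < 1"
    define r where "r = max (3 / 4) ((1 + r0) / 2)"
    have r: "r0 < r" "3 / 4 \<le> r" "r < 1" using \<open>r0 < 1\<close> by (auto simp: r_def less_max_iff_disj)
    have r2: "1 / 2 \<le> r\<^sup>2" "r\<^sup>2 < 1"
      using power_mono[OF r(2), of 2] r by (auto simp: power2_eq_square abs_square_less_1[unfolded power2_eq_square])
    obtain N :: nat where N: "1 / (1 - r\<^sup>2) < real N" using reals_Archimedean2 by blast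
    have "0 < 1 / (1 - r\<^sup>2)" using r2 by simp
    then have N0: "N > 0" using N by linarith
    have "1 / (1 - r\<^sup>2) \<le> (real N)\<^sup>2"
      using N N0 self_le_power[of "real N" 2] by linarith
    then have rN: "1 / (real N)\<^sup>2 \<le> 1 - r\<^sup>2" using r2 N0 by (simp add: field_simps)
    define G where "G = {0..<int N} \<times> {0..<int N} \<times> {0..<int N}"
    define x :: "int \<times> int \<times> int \<Rightarrow> real ^ 'm" where "x = grid_point a b c (\<delta> / N)"
    have x: "x j \<in> open_cube \<inter> ball 0 e" if "j \<in> G" for j
    proof -
      have coord: "\<bar>x j $ i\<bar> \<le> \<delta>" for i
        using that N0 \<delta> by (auto simp: x_def grid_point_def G_def abs_mult field_simps)
      have "norm (x j) \<le> (\<Sum>i\<in>UNIV. \<bar>x j $ i\<bar>)" by (rule norm_le_l1_cart)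
      also have "\<dots> \<le> CARD('m) * \<delta>" by (rule sum_bounded_above) (use coord in auto)
      finally have "norm (x j) < e" using \<delta> by simp
      moreover have "x j \<in> open_cube"
        unfolding open_cube_def using le_less_trans[OF coord \<delta>(2)] by (auto simp: abs_less_iff minus_less_iff)
      ultimately show ?thesis by simp
    qed
    have sep: "s\<^sup>2 * sqnorm3 (j - k) \<le> (real N)\<^sup>2 * (norm (\<phi> (x j) - \<phi> (x k)))\<^sup>2" if "j \<in> G" "k \<in> G" for j k
    proof -
      have "(\<delta> / N)\<^sup>2 * sqnorm3 (j - k) \<le> (norm (x j - x k))\<^sup>2"
        unfolding x_def by (rule grid_point_separation[OF abc])
      also have "\<dots> \<le> (L * norm (\<phi> (x j) - \<phi> (x k)))\<^sup>2"
        by (intro power_mono expand x that) auto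
      finally show ?thesis
        using N0 L by (simp add: s_def field_simps)
    qed
    have zZ: "\<phi> (x j) \<in> zero_set f \<inter> sphere 0 1" if "j \<in> G" for j
      using x[OF that] \<phi> by auto
    have "(\<Sum>j\<in>G. \<Sum>k\<in>G. 1 / cmod (1 - cinner_vec (r *\<^sub>R \<phi> (x j)) (r *\<^sub>R \<phi> (x k)))) \<le> 27 / \<kappa> * (real (card G))\<^sup>2"
      unfolding G_def
      by (rule spherical_grid_energy[OF N0 _ _ r2(1) rN \<kappa>]) (use zZ sep in \<open>auto simp: G_def\<close>)
    moreover have "finite G" "G \<noteq> {}" using N0 by (auto simp: G_def)
    ultimately show "\<exists>r J (z :: int \<times> int \<times> int \<Rightarrow> complex ^ 'd). r0 < r \<and> 0 < r \<and> r < 1 \<and> finite J \<and> J \<noteq> {} \<and>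
       z ` J \<subseteq> zero_set f \<inter> sphere 0 1 \<and>
       (\<Sum>j\<in>J. \<Sum>k\<in>J. 1 / cmod (1 - cinner_vec (r *\<^sub>R z j) (r *\<^sub>R z k))) \<le> 27 / \<kappa> * (real (card J))\<^sup>2"
      using r zZ by (intro exI[of _ r] exI[of _ G] exI[of _ "\<lambda>j. \<phi> (x j)"]) auto
  qed
qed

end
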